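(* There exist sequences $(w_k)_{k \ge 1}$ of complex numbers and $(a_k)_{k\ge1}$ of real numbers with $$ \operatorname{Re} w_k > \frac12, \quad a_k > 0 \quad (k \in \mathbb{N}), \qquad \lim_{k \to \infty} w_k = \infty, \qquad \sum_{k=1}^\infty a_k < \infty, $$ such that the function $$ F(w) = \sum_{k=1}^\infty \frac{a_k w_k}{w - w_k}, $$ which is meromorphic in $\mathbb{C}$, has no zeros in $\mathbb{C}$. Consequently the following assertion is false: for all $0 < \rho < \infty$, $\theta \in \mathbb{R}$ and all sequences $(z_k)_{k\ge1}$ in $\mathbb{C}$ and $(a_k)_{k\ge1}$ in $\mathbb{R}$ with $|z_k| < \rho$, $\lim_{k \to \infty} z_k = \rho e^{i\theta}$, $a_k > 0$ and $\sum_{k=1}^\infty a_k < \infty$, the function $f(z) = \sum_{k=1}^\infty \frac{a_k}{z - z_k}$ has infinitely many zeros in $|z| < \rho$.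
   Context: $F$ is regarded as a meromorphic function (with poles at the points $w_k$); a zero of $F$ is a point at which the meromorphic function takes the value $0$, and poles are not zeros. The same convention applies to $f$ in the disc $|z| < \rho$. *)

theory Defs
  imports "HOL-Complex_Analysis.Complex_Analysis"
begin

(* Sequences are indexed from 0.
   At z = p k the k-th term is c k / 0 = 0, so the value there is meaningless and must not be
   used; this is why zeros are always sought among the points z with "\<not> is_pole f z". *)
definition pole_series :: "(nat \<Rightarrow> complex) \<Rightarrow> (nat \<Rightarrow> complex) \<Rightarrow> complex \<Rightarrow> complex" where
  "pole_series c p z = (\<Sum>k. c k / (z - p k))"

end

theory Submission
  imports Defs
begin

text \<open>
  One looks for \<open>F = 1 / g\<close> with \<open>g\<close> entire, so that \<open>F\<close> has no zeros. Then \<open>F\<close> has the required form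
  if the zeros \<open>w\<close> of \<open>g\<close> satisfy \<open>w * g' w > 0\<close> and \<open>1 / g\<close> equals its partial fraction series.
  The choice \<open>g w = w - 2 + w * exp (2 * (w - 1))\<close> works: its zeros lie on \<open>Re w = 1\<close>, where
  \<open>w * g' w = 2 + 2 * \<bar>w\<bar>\<^sup>2\<close>. Below, \<open>G s = g (1 + s)\<close>. On the square with centre \<open>0\<close> and half side
  \<open>\<pi> * n\<close> one has \<open>\<bar>G\<bar> \<ge> \<pi> * n / 2\<close> (on the horizontal sides because \<open>exp (2 * s)\<close> is positive
  there), so the residue theorem applied to \<open>1 / (G s * (s - s0))\<close> gives the expansion along the
  squares. At \<open>s0 = -1\<close>, i.e. \<open>w = 0\<close>, this expansion is minus the sum of the positive weights;
  hence the weights are summable and the order of summation is irrelevant.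
\<close>

section \<open>The entire function \<open>G\<close>, its zeros and their weights\<close>

text \<open>The factors \<open>s - 1\<close> and \<open>s + 1\<close> are, up to sign, reflections of each other in the imaginary axis, which
  forces all zeros onto that axis; there \<open>1 - p\<close> is the conjugate of \<open>p + 1\<close>, and this is what
  makes \<open>(p + 1) * G' p\<close> positive.\<close>
definition G :: "complex \<Rightarrow> complex" where
  "G s = (s - 1) + (s + 1) * exp (2 * s)"

definition G_zeros :: "complex set" where
  "G_zeros = {s. G s = 0}"

text \<open>At a zero \<open>p\<close> of \<open>G\<close> this is
  \<open>1 / ((p + 1) * G' p)\<close>. Hence the residue of \<open>1 / G\<close> at \<open>p\<close>
  is \<open>weight p * (p + 1)\<close>, which has the required shape \<open>a k * w k\<close> with
  \<open>w k = p + 1\<close>.\<close>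

definition weight :: "complex \<Rightarrow> real" where
  "weight p = 1 / (4 + 2 * (cmod p)\<^sup>2)"

lemma weight_pos: "weight p > 0"
  using zero_le_power2[of "cmod p"] by (simp add: weight_def add_pos_nonneg)

lemma holomorphic_G [holomorphic_intros]: "f holomorphic_on A \<Longrightarrow> (\<lambda>z. G (f z)) holomorphic_on A"
  unfolding G_def by (intro holomorphic_intros)

lemma G_has_field_derivative:
  "(G has_field_derivative 1 + (2 * s + 3) * exp (2 * s)) (at s)"
proof -
  have "((\<lambda>s. (s - 1) + (s + 1) * exp (2 * s)) has_field_derivative
          (1 - 0) + ((1 + 0) * exp (2 * s) + (exp (2 * s) * (2 * 1)) * (s + 1))) (at s)"
    by (intro DERIV_add DERIV_diff DERIV_mult DERIV_chain2[OF DERIV_exp] DERIV_cmult DERIV_ident DERIV_const)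
  moreover have "(1 - 0) + ((1 + 0) * exp (2 * s) + (exp (2 * s) * (2 * 1)) * (s + 1))
      = 1 + (2 * s + 3) * exp (2 * s)"
    by (simp add: distrib_right distrib_left)
  ultimately show ?thesis unfolding G_def by simp
qed

lemma cmod_add_1_minus_cmod_diff_1:
  "(cmod (s + 1))\<^sup>2 - (cmod (s - 1))\<^sup>2 = 4 * Re s"
  by (subst (1 2) cmod_power2) (simp add: power2_eq_square algebra_simps)

lemma cmod_diff_1_le: "Re s \<ge> 0 \<Longrightarrow> cmod (s - 1) \<le> cmod (s + 1)"
  by (rule power2_le_imp_le[OF _ norm_ge_zero], use cmod_add_1_minus_cmod_diff_1[of s] in linarith)

lemma cmod_add_1_le: "Re s \<le> 0 \<Longrightarrow> cmod (s + 1) \<le> cmod (s - 1)"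
  by (rule power2_le_imp_le[OF _ norm_ge_zero], use cmod_add_1_minus_cmod_diff_1[of s] in linarith)

text \<open>Comparing moduli at a zero gives \<open>|s - 1| = |s + 1| * exp (2 * Re s)\<close>. To
  the right of the imaginary axis \<open>|s + 1|\<close> is already the larger modulus and the
  exponential exceeds 1; to the left both comparisons reverse.\<close>

lemma G_zero_imp_Re_0:
  assumes "G s = 0"
  shows "Re s = 0"
proof -
  have eq: "cmod (s - 1) = cmod (s + 1) * exp (2 * Re s)"
  proof -
    have "s - 1 = - ((s + 1) * exp (2 * s))"
      using assms by (simp add: G_def add_eq_0_iff2)
    then have "cmod (s - 1) = cmod ((s + 1) * exp (2 * s))" by simp
    then show ?thesis by (simp add: norm_mult)
  qed
  have nz: "s \<noteq> 1" "s \<noteq> -1" using assms by (auto simp: G_def)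
  show ?thesis
  proof (rule ccontr)
    assume "Re s \<noteq> 0"
    then consider "Re s > 0" | "Re s < 0" by linarith
    then show False
    proof cases
      case 1
      have "cmod (s + 1) * 1 < cmod (s + 1) * exp (2 * Re s)"
        using 1 nz by (intro mult_strict_left_mono) (auto simp: add_eq_0_iff2)
      then show False using cmod_diff_1_le[of s] 1 eq by simp
    next
      case 2
      have "cmod (s + 1) * exp (2 * Re s) < cmod (s + 1) * 1"
        using 2 nz by (intro mult_strict_left_mono) (auto simp: add_eq_0_iff2)
      then show False using cmod_add_1_le[of s] 2 eq by simp
    qed
  qed
qed

text \<open>The equation \<open>G p = 0\<close> eliminates the exponential and leaves
  \<open>4 - 2 * p^2\<close>; since \<open>p\<close> is purely imaginary,
  \<open>p^2 = -|p|^2\<close>.\<close>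

lemma times_deriv_G:
  assumes "G p = 0"
  shows "(p + 1) * (1 + (2 * p + 3) * exp (2 * p)) = of_real (4 + 2 * (cmod p)\<^sup>2)"
proof -
  have e: "(p + 1) * exp (2 * p) = 1 - p"
    using assms unfolding G_def by (simp add: algebra_simps eq_neg_iff_add_eq_0)
  have "(p + 1) * (1 + (2 * p + 3) * exp (2 * p)) = (p + 1) + (2 * p + 3) * ((p + 1) * exp (2 * p))"
    by (simp add: algebra_simps)
  also have "\<dots> = 4 - 2 * p\<^sup>2"
    unfolding e by (simp add: algebra_simps power2_eq_square)
  also have "\<dots> = of_real (4 + 2 * (cmod p)\<^sup>2)"
    using G_zero_imp_Re_0[OF assms]
    by (simp add: complex_eq_iff cmod_power2 Re_power2 Im_power2)
  finally show ?thesis .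
qed

text \<open>Supplies the residues of \<open>1 / G\<close> in terms of the weights, and the
  simplicity of the zeros of \<open>G\<close>.\<close>

lemma deriv_G_inverse:
  fixes p :: complex
  assumes "G p = 0"
  shows "1 / (1 + (2 * p + 3) * exp (2 * p)) = weight p * (p + 1)"
    and "1 + (2 * p + 3) * exp (2 * p) \<noteq> 0"
proof -
  define d where "d = 1 + (2 * p + 3) * exp (2 * p)"
  define m where "m = complex_of_real (4 + 2 * (cmod p)\<^sup>2)"
  have "4 + 2 * (cmod p)\<^sup>2 > 0" by (intro add_pos_nonneg) auto
  then have m: "m \<noteq> 0"
    unfolding m_def by (metis of_real_eq_0_iff less_irrefl)
  have dm: "(p + 1) * d = m"
    unfolding d_def m_def by (rule times_deriv_G[OF assms])
  have w: "complex_of_real (weight p) = 1 / m"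
    unfolding weight_def m_def of_real_divide by simp
  from dm m have d: "d \<noteq> 0" by auto
  then have "1 / d = 1 / m * (p + 1)" using m unfolding dm[symmetric] by simp
  with w d show "1 / (1 + (2 * p + 3) * exp (2 * p)) = weight p * (p + 1)"
    and "1 + (2 * p + 3) * exp (2 * p) \<noteq> 0"
    unfolding d_def by simp_all
qed

lemma finite_G_zeros_cball: "finite (G_zeros \<inter> cball 0 r)"
proof -
  have nc: "\<not> G constant_on UNIV"
  proof
    assume "G constant_on UNIV"
    then obtain y where "\<And>s. G s = y" unfolding constant_on_def by blast
    then have "G 0 = G (-1)" by metis
    moreover have "G 0 = 0" "G (-1) = -2" by (simp_all add: G_def)
    ultimately show False by simp
  qed
  have "G holomorphic_on UNIV" by (rule holomorphic_G[OF holomorphic_on_ident])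
  then have "finite {z\<in>cball 0 r. G z = 0}"
    using nc by (rule holomorphic_compact_finite_zeros[OF _ open_UNIV connected_UNIV compact_cball subset_UNIV])
  moreover have "{z\<in>cball 0 r. G z = 0} = G_zeros \<inter> cball 0 r" unfolding G_zeros_def by blast
  ultimately show ?thesis by simp
qed

section \<open>Lower bounds for \<open>G\<close> on the sides of the squares\<close>

lemma exp_double_gt_2: "exp (2 * x) > (2::real)" if "x \<ge> 1"
  using that exp_ge_add_one_self[of "2 * x"] by linarith

text \<open>On these lines \<open>exp (2 * s)\<close> is a positive real, so the two summands of
  \<open>Im (G s)\<close> have the same sign and cannot cancel.\<close>

lemma G_lower_bound_horizontal:
  assumes "Im s = pi * of_int n"
  shows "cmod (G s) \<ge> \<bar>Im s\<bar>"
proof -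
  have "exp (2 * s) = of_real (exp (2 * Re s))"
  proof -
    have "cos (2 * (pi * of_int n)) = 1" "sin (2 * (pi * of_int n)) = 0"
      by (simp_all add: mult.assoc[symmetric] cos_int_2pin sin_int_2pin)
    then show ?thesis using assms by (simp add: complex_eq_iff Re_exp Im_exp)
  qed
  then have "Im (G s) = Im s * (1 + exp (2 * Re s))"
    by (simp add: G_def algebra_simps)
  then have "\<bar>Im (G s)\<bar> = \<bar>Im s\<bar> * (1 + exp (2 * Re s))"
    by (simp add: abs_mult)
  also have "\<dots> \<ge> \<bar>Im s\<bar> * 1" by (intro mult_left_mono) auto
  finally show ?thesis using abs_Im_le_cmod[of "G s"] by linarith
qed

text \<open>Far from the imaginary axis one summand of \<open>G\<close> dominates: on the right
  \<open>(s + 1) * exp (2 * s)\<close> has at least twice the modulus of \<open>s - 1\<close>, on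
  the left at most half of it.\<close>

lemma G_lower_bound_vertical:
  assumes "\<bar>Re s\<bar> \<ge> 2"
  shows "cmod (G s) \<ge> \<bar>Re s\<bar> / 2"
proof (cases "Re s \<ge> 0")
  case True
  have "cmod (s - 1) * 2 \<le> cmod (s + 1) * exp (2 * Re s)"
    using True assms exp_double_gt_2[of "Re s"] by (intro mult_mono cmod_diff_1_le) auto
  also have "\<dots> = cmod ((s + 1) * exp (2 * s))" by (simp add: norm_mult)
  also have "\<dots> \<le> cmod (G s) + cmod (s - 1)"
    unfolding G_def by (metis norm_triangle_ineq4 add_diff_cancel_left')
  finally have "cmod (s - 1) \<le> cmod (G s)" by simp
  moreover have "Re s - 1 \<le> cmod (s - 1)" using complex_Re_le_cmod[of "s - 1"] by simp
  ultimately show ?thesis using True assms by linarith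
next
  case False
  have "cmod ((s + 1) * exp (2 * s)) = cmod (s + 1) * exp (2 * Re s)" by (simp add: norm_mult)
  also have "\<dots> \<le> cmod (s - 1) * (1 / 2)"
  proof (intro mult_mono cmod_add_1_le)
    have "exp (2 * Re s) = 1 / exp (2 * (- Re s))" by (simp add: exp_minus field_simps)
    also have "\<dots> \<le> 1 / 2" using exp_double_gt_2[of "- Re s"] assms False by (intro divide_left_mono) auto
    finally show "exp (2 * Re s) \<le> 1 / 2" .
  qed (use False in auto)
  finally have "cmod (s - 1) / 2 \<le> cmod (G s)"
    using norm_triangle_ineq4[of "G s" "(s + 1) * exp (2 * s)"] unfolding G_def by simp
  moreover have "1 - Re s \<le> cmod (s - 1)" using complex_Re_le_cmod[of "1 - s"]
    by (simp add: norm_minus_commute)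
  ultimately show ?thesis using False assms by linarith
qed

section \<open>Infinitude of the zeros\<close>

text \<open>On the imaginary axis \<open>G (i * y)\<close> is \<open>2 * i * exp (i * y)\<close>
  times the real function \<open>h y = y * cos y + sin y\<close>, whose value at
  \<open>pi * k\<close> is \<open>pi * k\<close> with sign \<open>(-1)^k\<close>; the intermediate
  value theorem does the rest.\<close>

lemma infinite_G_zeros: "infinite G_zeros"
proof
  define h where "h y = y * cos y + sin y" for y :: real
  assume fin: "finite G_zeros"
  have "\<exists>y. pi * real n \<le> y \<and> h y = 0" for n :: nat
  proof -
    have "continuous_on A h" for A unfolding h_def by (intro continuous_intros)
    then have cont: "continuous_on {pi * real n..pi * real (Suc n)} h" 
      and cont': "continuous_on {pi * real n..pi * real (Suc n)} (\<lambda>x. - h x)"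
      by (auto intro: continuous_intros)
    have le: "pi * real n \<le> pi * real (Suc n)" by simp
    have ev: "h (pi * real k) = (if even k then 1 else -1) * (pi * real k)" for k
      by (cases "even k") (simp_all add: h_def)
    show ?thesis
    proof (cases "even n")
      case True
      \<comment> \<open>For even \<open>n\<close> the function \<open>h\<close> descends through 0,
        so the theorem for ascending functions is applied to \<open>- h\<close>.\<close>
      have "\<exists>x\<ge>pi * real n. x \<le> pi * real (Suc n) \<and> - h x = 0"
        using True ev[of n] ev[of "Suc n"] by (intro IVT'[OF _ _ le cont']) auto
      then show ?thesis by auto
    next
      case False
      have "\<exists>x\<ge>pi * real n. x \<le> pi * real (Suc n) \<and> h x = 0"
        using False ev[of n] ev[of "Suc n"] by (intro IVT'[OF _ _ le cont]) auto
      then show ?thesis by auto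
    qed
  qed
  then obtain y where y: "\<And>n::nat. pi * real n \<le> y n" "\<And>n. h (y n) = 0" by metis
  have "\<i> * of_real (y n) \<in> G_zeros" for n
  proof -
    let ?y = "y n"
    have "G (\<i> * of_real ?y) = exp (\<i> * of_real ?y) * (2 * \<i> * of_real (h ?y))"
    proof -
      define e where "e = exp (\<i> * of_real ?y)"
      have 1: "exp (2 * (\<i> * of_real ?y)) = e * e"
        unfolding e_def by (simp add: exp_add[symmetric])
      have "e * exp (- (\<i> * of_real ?y)) = 1"
        unfolding e_def by (simp add: exp_minus)
      moreover have "exp (- (\<i> * of_real ?y)) = cos (of_real ?y) - \<i> * sin (of_real ?y)"
        by (metis exp_Euler cos_minus mult_minus_right sin_minus uminus_add_conv_diff add.commute)
      ultimately have 2: "e * (cos (of_real ?y) - \<i> * sin (of_real ?y)) = 1" by simp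
      have 3: "e = cos (of_real ?y) + \<i> * sin (of_real ?y)"
        unfolding e_def by (rule exp_Euler)
      \<comment> \<open>Inserting the factor \<open>e * exp (- i * y) = 1\<close> into the first
        summand allows \<open>e\<close> to be pulled out of both.\<close>
      have "G (\<i> * of_real ?y) = (\<i> * ?y - 1) * (e * (cos (of_real ?y) - \<i> * sin (of_real ?y))) + (\<i> * ?y + 1) * (e * e)"
        unfolding G_def 1 2 by simp
      also have "\<dots> = e * ((\<i> * ?y - 1) * (cos (of_real ?y) - \<i> * sin (of_real ?y)) + (\<i> * ?y + 1) * e)"
        by (simp add: algebra_simps)
      also have "(\<i> * ?y - 1) * (cos (of_real ?y) - \<i> * sin (of_real ?y)) + (\<i> * ?y + 1) * e = 2 * \<i> * of_real (h ?y)"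
        unfolding 3 h_def by (simp add: algebra_simps cos_of_real sin_of_real)
      finally show ?thesis by (simp add: e_def)
    qed
    then show ?thesis by (simp add: G_zeros_def y)
  qed
  \<comment> \<open>Finiteness is refuted through boundedness: the heights satisfy
    \<open>y n \<ge> pi * real n\<close>.\<close>
  then have "range (\<lambda>n. \<i> * of_real (y n) :: complex) \<subseteq> G_zeros" by blast
  with finite_imp_bounded[OF fin] have "bounded (range (\<lambda>n. \<i> * of_real (y n) :: complex))"
    by (rule bounded_subset)
  then obtain B where "\<And>n. cmod (\<i> * of_real (y n)) \<le> B" by (auto simp: bounded_iff)
  then have B: "y n \<le> B" for n by (simp add: norm_mult abs_le_iff)
  obtain n where "real n > B / pi" using reals_Archimedean2 by blast
  then have "pi * real n > B" by (simp add: field_simps)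
  with B[of n] y(1)[of n] show False by linarith
qed

section \<open>Residue theorem on the squares\<close>

text \<open>These are the zeros inside the square with centre 0 and half side \<open>pi * n\<close>;
  all zeros are purely imaginary, so only the imaginary part has to be restricted.\<close>

definition G_zeros_upto :: "nat \<Rightarrow> complex set" where
  "G_zeros_upto n = {p \<in> G_zeros. \<bar>Im p\<bar> < pi * real n}"

lemma G_zeros_upto_subset: "G_zeros_upto n \<subseteq> G_zeros"
  by (auto simp: G_zeros_upto_def)

lemma finite_G_zeros_upto: "finite (G_zeros_upto n)"
proof (rule finite_subset)
  show "G_zeros_upto n \<subseteq> G_zeros \<inter> cball 0 (pi * real n)"
  proof
    fix p assume "p \<in> G_zeros_upto n"
    then have "p \<in> G_zeros" "Re p = 0" "\<bar>Im p\<bar> < pi * real n"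
      using G_zero_imp_Re_0 by (auto simp: G_zeros_upto_def G_zeros_def)
    with cmod_le[of p] show "p \<in> G_zeros \<inter> cball 0 (pi * real n)" by simp
  qed
qed (rule finite_G_zeros_cball)

text \<open>The standard length estimate, side by side; the factor after \<open>B\<close> is the
  perimeter.\<close>

lemma norm_contour_integral_rectpath_le:
  assumes "Re a \<le> Re b" "Im a \<le> Im b"
      and cont: "continuous_on (path_image (rectpath a b)) f"
      and B: "\<And>z. z \<in> path_image (rectpath a b) \<Longrightarrow> cmod (f z) \<le> B"
  shows "cmod (contour_integral (rectpath a b) f) \<le> B * (2 * (Re b - Re a) + 2 * (Im b - Im a))"
proof -
  define c d where "c = Complex (Re b) (Im a)" and "d = Complex (Re a) (Im b)"
  have rect: "rectpath a b = linepath a c +++ linepath c b +++ linepath b d +++ linepath d a"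
    by (simp add: rectpath_def c_def d_def Let_def)
  have pim: "path_image (rectpath a b) =
      closed_segment a c \<union> closed_segment c b \<union> closed_segment b d \<union> closed_segment d a"
    by (simp add: rect path_image_join Un_assoc)
  have "a \<in> path_image (rectpath a b)" by (simp add: pim)
  with B have "0 \<le> B" using norm_ge_zero order_trans by blast
  have int: "f contour_integrable_on linepath x y"
    and bd: "cmod (contour_integral (linepath x y) f) \<le> B * cmod (y - x)"
    if "closed_segment x y \<subseteq> path_image (rectpath a b)" for x y
  proof -
    show *: "f contour_integrable_on linepath x y"
      by (rule contour_integrable_continuous_linepath[OF continuous_on_subset[OF cont that]])
    show "cmod (contour_integral (linepath x y) f) \<le> B * cmod (y - x)"
      by (rule contour_integral_bound_linepath[OF * \<open>0 \<le> B\<close>]) (use that B in blast)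
  qed
  have sub: "closed_segment a c \<subseteq> path_image (rectpath a b)"
    "closed_segment c b \<subseteq> path_image (rectpath a b)"
    "closed_segment b d \<subseteq> path_image (rectpath a b)"
    "closed_segment d a \<subseteq> path_image (rectpath a b)"
    unfolding pim by blast+
  have "contour_integral (rectpath a b) f =
      contour_integral (linepath a c) f + (contour_integral (linepath c b) f +
       (contour_integral (linepath b d) f + contour_integral (linepath d a) f))"
    unfolding rect by (simp add: int sub)
  also have "cmod \<dots> \<le> B * cmod (c - a) + (B * cmod (b - c) + (B * cmod (d - b) + B * cmod (a - d)))"
    by (intro norm_triangle_mono bd sub)
  also have "\<dots> = B * (cmod (c - a) + cmod (b - c) + cmod (d - b) + cmod (a - d))"
    by (simp add: distrib_left)
  also have "cmod (c - a) + cmod (b - c) + cmod (d - b) + cmod (a - d)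
      = 2 * (Re b - Re a) + 2 * (Im b - Im a)"
    using assms(1,2) by (simp add: c_def d_def cmod_def)
  finally show ?thesis .
qed

text \<open>At the simple pole \<open>p\<close> the residue is \<open>1 / (G' p * (p - s0))\<close>.
  The minus sign comes from writing \<open>s0 - p\<close>, as in the series to be obtained.\<close>

lemma residue_at_G_zero:
  fixes p s0 :: complex
  assumes "p \<in> G_zeros" "s0 \<notin> G_zeros"
  shows "residue (\<lambda>s. 1 / (G s * (s - s0))) p = - (weight p * (p + 1) / (s0 - p))"
proof -
  define d where "d = 1 + (2 * p + 3) * exp (2 * p)"
  have Gp: "G p = 0" using assms by (simp add: G_zeros_def)
  have ne: "p \<noteq> s0" using assms by auto
  note d = deriv_G_inverse[OF Gp, folded d_def]
  \<comment> \<open>The radius is capped at 1 so that only the finitely many zeros in the disc of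
    radius \<open>cmod p + 1\<close> have to be avoided.\<close>
  obtain r where r: "r > 0" "\<And>s. s \<in> ball p r - {p} \<Longrightarrow> G s \<noteq> 0 \<and> s \<noteq> s0"
  proof -
    have fin: "finite (insert s0 (G_zeros \<inter> cball 0 (cmod p + 1)) - {p})"
      using finite_G_zeros_cball by simp
    obtain e where e: "e > 0" "\<And>x. x \<in> insert s0 (G_zeros \<inter> cball 0 (cmod p + 1)) - {p} \<Longrightarrow> x \<noteq> p \<Longrightarrow> e \<le> dist p x"
      using finite_set_avoid[OF fin, of p] by blast
    show ?thesis
    proof (rule that[of "min e 1"])
      fix s assume s: "s \<in> ball p (min e 1) - {p}"
      then have "dist p s < e" "dist p s < 1" "s \<noteq> p" by auto
      then have "cmod s \<le> cmod p + 1"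
        using norm_triangle_sub[of s p] by (simp add: dist_norm norm_minus_commute)
      then show "G s \<noteq> 0 \<and> s \<noteq> s0"
        using e(2)[of s] \<open>dist p s < e\<close> \<open>s \<noteq> p\<close> by (auto simp: G_zeros_def)
    qed (use e in auto)
  qed
  have "residue (\<lambda>s. 1 / (G s * (s - s0))) p = (1 / d) * (1 / (p - s0))"
  proof (rule residue_simple')
    show "(\<lambda>s. 1 / (G s * (s - s0))) holomorphic_on ball p r - {p}"
      using r by (intro holomorphic_intros) auto
    have "((\<lambda>s. (G s - G p) / (s - p)) \<longlongrightarrow> d) (at p)"
      using G_has_field_derivative[of p] by (simp add: has_field_derivative_iff d_def)
    then have lim: "((\<lambda>s. 1 / ((G s - G p) / (s - p)) * (1 / (s - s0))) \<longlongrightarrow> 1 / d * (1 / (p - s0))) (at p)"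
      using d(2) ne by (intro tendsto_intros) auto
    have eq: "1 / ((G s - G p) / (s - p)) * (1 / (s - s0)) = 1 / (G s * (s - s0)) * (s - p)" for s
      unfolding Gp by simp
    show "((\<lambda>s. 1 / (G s * (s - s0)) * (s - p)) \<longlongrightarrow> 1 / d * (1 / (p - s0))) (at p)"
      using lim by (simp only: eq)
  qed (use r in auto)
  also have "\<dots> = - (weight p * (p + 1) / (s0 - p))"
  proof -
    have "p - s0 = - (s0 - p)" by simp
    then show ?thesis unfolding d(1) by (simp only: minus_divide_right mult_1_right times_divide_eq_right)
  qed
  finally show ?thesis .
qed

lemma residue_at_G_nonzero:
  fixes s0 :: complex
  assumes "s0 \<notin> G_zeros"
  shows "residue (\<lambda>s. 1 / (G s * (s - s0))) s0 = 1 / G s0"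
proof -
  have "isCont G s0" using DERIV_isCont[OF G_has_field_derivative] .
  moreover have "G s0 \<noteq> 0" using assms by (simp add: G_zeros_def)
  ultimately obtain e where e: "e > 0" "\<And>s. dist s0 s < e \<Longrightarrow> G s \<noteq> 0"
    using continuous_at_avoid[of s0 G 0] by blast
  have "residue (\<lambda>s. (1 / G s) / (s - s0)) s0 = 1 / G s0"
    using e by (intro residue_simple[of "ball s0 e"] holomorphic_intros) auto
  then show ?thesis by simp
qed

text \<open>The error is the integral of \<open>1 / (G s * (s - s0))\<close> over the square,
  divided by \<open>2 * pi * i\<close>. On the boundary both factors are at least
  \<open>M / 2\<close>, so the integrand is at most \<open>4 / M^2\<close>; the perimeter is
  \<open>8 * M\<close>, and \<open>32 / M\<close> over \<open>2 * pi\<close> gives the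
  bound.\<close>

lemma partial_fractions_error_le:
  fixes s0 :: complex
  assumes s0: "s0 \<notin> G_zeros" and n: "pi * real n > 2 * cmod s0" "n \<ge> 1"
  defines "M \<equiv> pi * real n"
  shows "cmod (1 / G s0 - (\<Sum>p\<in>G_zeros_upto n. weight p * (p + 1) / (s0 - p))) \<le> 16 / (pi * M)"
proof -
  define a b where "a = Complex (-M) (-M)" and "b = Complex M M"
  define f where "f s = 1 / (G s * (s - s0))" for s
  \<comment> \<open>This makes the bound for the vertical sides applicable, which asks for
    \<open>|Re s| \<ge> 2\<close>.\<close>
  have M: "M > 3"
  proof -
    have "pi * 1 \<le> M" unfolding M_def using n(2) by (intro mult_left_mono) auto
    then show ?thesis using pi_gt3 by linarith
  qed
  have ab [simp]: "Re a = -M" "Im a = -M" "Re b = M" "Im b = M" by (simp_all add: a_def b_def)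
  have low: "cmod (G s) \<ge> M / 2" "cmod (s - s0) \<ge> M / 2"
    if "s \<in> path_image (rectpath a b)" for s
  proof -
    have s: "(\<bar>Re s\<bar> = M \<or> \<bar>Im s\<bar> = M)"
      using that M by (subst (asm) path_image_rectpath) auto
    show "cmod (G s) \<ge> M / 2"
    proof (cases "\<bar>Re s\<bar> = M")
      case True
      then show ?thesis using G_lower_bound_vertical[of s] M by linarith
    next
      case False
      with s have Im: "\<bar>Im s\<bar> = M" by simp
      then have "Im s = pi * of_int (int n) \<or> Im s = pi * of_int (- int n)"
        unfolding M_def by (auto simp: abs_if split: if_splits)
      then have "\<bar>Im s\<bar> \<le> cmod (G s)" using G_lower_bound_horizontal by blast
      then show ?thesis using Im M by linarith
    qed
    have "M \<le> cmod s" using s abs_Re_le_cmod[of s] abs_Im_le_cmod[of s] by linarith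
    moreover have "cmod s \<le> cmod (s - s0) + cmod s0"
      by (metis diff_add_cancel norm_triangle_ineq)
    ultimately show "cmod (s - s0) \<ge> M / 2" using n(1) unfolding M_def[symmetric] by linarith
  qed
  \<comment> \<open>Points of the square have modulus at most \<open>2 * M\<close>, so this ball
    contains it; being bounded, the ball meets only finitely many poles.\<close>
  define S where "S = ball (0 :: complex) (3 * M)"
  define P where "P = insert s0 (G_zeros \<inter> S)"
  have finP: "finite P"
    unfolding P_def S_def
    by (simp, rule finite_subset[OF _ finite_G_zeros_cball[of "3 * M"]]) auto
  have holo: "f holomorphic_on S - P"
    unfolding f_def by (intro holomorphic_intros) (auto simp: P_def G_zeros_def)
  have cboxS: "cbox a b \<subseteq> S"
  proof
    fix z assume "z \<in> cbox a b"
    then have "\<bar>Re z\<bar> \<le> M" "\<bar>Im z\<bar> \<le> M" by (auto simp: in_cbox_complex_iff)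
    then show "z \<in> S" using cmod_le[of z] M by (simp add: S_def)
  qed
  have pimS: "path_image (rectpath a b) \<subseteq> S - P"
  proof -
    have "path_image (rectpath a b) \<subseteq> cbox a b"
      by (rule path_image_rectpath_subset_cbox) (use M in auto)
    moreover have "s \<notin> P" if "s \<in> path_image (rectpath a b)" for s
      using low[OF that] M by (auto simp: P_def G_zeros_def)
    ultimately show ?thesis using cboxS by auto
  qed
  have s0box: "s0 \<in> box a b"
  proof -
    have "\<bar>Re s0\<bar> < M" "\<bar>Im s0\<bar> < M"
      using n(1) M abs_Re_le_cmod[of s0] abs_Im_le_cmod[of s0] unfolding M_def[symmetric] by linarith+
    then show ?thesis by (auto simp: in_box_complex_iff)
  qed
  have Zbox: "p \<in> box a b \<longleftrightarrow> p \<in> G_zeros_upto n" if "p \<in> G_zeros" for p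
    using G_zero_imp_Re_0[of p] that M
    by (auto simp: in_box_complex_iff G_zeros_upto_def G_zeros_def M_def[symmetric])
  have wind: "winding_number (rectpath a b) p = (if p \<in> box a b then 1 else 0)" if "p \<in> P" for p
  proof (cases "p \<in> box a b")
    case True
    then show ?thesis by (simp add: winding_number_rectpath)
  next
    case False
    moreover have "p \<notin> path_image (rectpath a b)" using that pimS by auto
    ultimately have "p \<notin> cbox a b"
      by (subst (asm) path_image_rectpath_cbox_minus_box) (use M in auto)
    then show ?thesis using False M by (simp add: winding_number_rectpath_outside)
  qed
  have "contour_integral (rectpath a b) f =
      2 * pi * \<i> * (\<Sum>p\<in>P. winding_number (rectpath a b) p * residue f p)"
  proof (rule Residue_theorem[of S P f "rectpath a b"])
    show "\<forall>z. z \<notin> S \<longrightarrow> winding_number (rectpath a b) z = 0"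
      using cboxS M by (auto intro!: winding_number_rectpath_outside)
  qed (use finP holo pimS in \<open>auto simp: S_def\<close>)
  also have "(\<Sum>p\<in>P. winding_number (rectpath a b) p * residue f p)
      = (\<Sum>p\<in>P. if p \<in> box a b then residue f p else 0)"
    by (rule sum.cong) (simp_all add: wind)
  also have "\<dots> = (\<Sum>p\<in>P \<inter> box a b. residue f p)"
    using finP by (simp add: sum.inter_restrict)
  also have "P \<inter> box a b = insert s0 (G_zeros_upto n)"
  proof -
    have "G_zeros \<inter> box a b = G_zeros_upto n" using Zbox G_zeros_upto_subset by blast
    moreover have "box a b \<subseteq> S" using cboxS box_subset_cbox by blast
    ultimately show ?thesis unfolding P_def using s0box by blast
  qed
  also have "(\<Sum>p\<in>insert s0 (G_zeros_upto n). residue f p) = residue f s0 + (\<Sum>p\<in>G_zeros_upto n. residue f p)"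
    using s0 G_zeros_upto_subset[of n] finite_G_zeros_upto by (subst sum.insert) auto
  also have "\<dots> = 1 / G s0 - (\<Sum>p\<in>G_zeros_upto n. weight p * (p + 1) / (s0 - p))"
  proof -
    have "(\<Sum>p\<in>G_zeros_upto n. residue f p) = (\<Sum>p\<in>G_zeros_upto n. - (weight p * (p + 1) / (s0 - p)))"
    proof (rule sum.cong[OF refl])
      fix p assume "p \<in> G_zeros_upto n"
      then have "p \<in> G_zeros" using G_zeros_upto_subset by blast
      then show "residue f p = - (weight p * (p + 1) / (s0 - p))"
        unfolding f_def using s0 by (rule residue_at_G_zero)
    qed
    moreover have "residue f s0 = 1 / G s0"
      unfolding f_def by (rule residue_at_G_nonzero[OF s0])
    ultimately show ?thesis by (simp add: sum_negf)
  qed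
  finally have eq: "contour_integral (rectpath a b) f =
    2 * pi * \<i> * (1 / G s0 - (\<Sum>p\<in>G_zeros_upto n. weight p * (p + 1) / (s0 - p)))" .
  have "cmod (contour_integral (rectpath a b) f)
     \<le> 4 / M\<^sup>2 * (2 * (Re b - Re a) + 2 * (Im b - Im a))"
  proof (rule norm_contour_integral_rectpath_le)
    show "continuous_on (path_image (rectpath a b)) f"
      using holomorphic_on_imp_continuous_on[OF holo] continuous_on_subset pimS by blast
    fix s assume "s \<in> path_image (rectpath a b)"
    note l = low[OF this]
    have "cmod (f s) = 1 / (cmod (G s) * cmod (s - s0))"
      by (simp add: f_def norm_divide norm_mult)
    also have "\<dots> \<le> 1 / (M / 2 * (M / 2))"
    proof (rule divide_left_mono)
      show "M / 2 * (M / 2) \<le> cmod (G s) * cmod (s - s0)"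
        using l M by (intro mult_mono) auto
      then show "0 < cmod (G s) * cmod (s - s0) * (M / 2 * (M / 2))"
        using M l by (intro mult_pos_pos) linarith+
    qed auto
    finally show "cmod (f s) \<le> 4 / M\<^sup>2" by (simp add: power2_eq_square)
  qed (use M in auto)
  also have "\<dots> = 32 / M"
    using M by (simp add: power2_eq_square)
  finally have "2 * pi * cmod (1 / G s0 - (\<Sum>p\<in>G_zeros_upto n. weight p * (p + 1) / (s0 - p))) \<le> 32 / M"
    unfolding eq norm_mult by simp
  moreover have "x \<le> 16 / (pi * M)" if "2 * pi * x \<le> 32 / M" for x
    using that M by (simp add: field_simps)
  ultimately show ?thesis by blast
qed

lemma partial_fractions_limit:
  fixes s0 :: complex
  assumes "s0 \<notin> G_zeros"
  shows "(\<lambda>n. \<Sum>p\<in>G_zeros_upto n. weight p * (p + 1) / (s0 - p)) \<longlonglongrightarrow> 1 / G s0"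
proof (rule LIM_zero_cancel, rule Lim_null_comparison)
  obtain N :: nat where N: "real N > 2 * cmod s0 / pi" using reals_Archimedean2 by blast
  show "\<forall>\<^sub>F n in sequentially. norm ((\<Sum>p\<in>G_zeros_upto n. weight p * (p + 1) / (s0 - p)) - 1 / G s0)
          \<le> 16 / (pi * (pi * real n))"
    using eventually_ge_at_top[of "max N 1"]
  proof eventually_elim
    case (elim n)
    then have "real n > 2 * cmod s0 / pi" using N by linarith
    then have "pi * real n > 2 * cmod s0" by (simp add: field_simps)
    from partial_fractions_error_le[OF assms this] elim show ?case
      by (simp add: norm_minus_commute)
  qed
  have "(\<lambda>n. 16 / (pi * pi) * inverse (real n)) \<longlonglongrightarrow> 16 / (pi * pi) * 0"
    by (intro tendsto_mult tendsto_const lim_inverse_n)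
  then show "(\<lambda>n. 16 / (pi * (pi * real n))) \<longlonglongrightarrow> 0"
    by (simp add: field_simps)
qed

section \<open>From limits along squares to unordered sums\<close>

lemma finite_subset_G_zeros_upto:
  assumes "finite F" "F \<subseteq> G_zeros"
  obtains N where "\<And>n. n \<ge> N \<Longrightarrow> F \<subseteq> G_zeros_upto n"
proof -
  obtain B where B: "\<And>p. p \<in> F \<Longrightarrow> cmod p \<le> B"
    using finite_imp_bounded[OF assms(1)] by (auto simp: bounded_iff)
  obtain N :: nat where N: "B / pi < real N" using reals_Archimedean2 by blast
  have "F \<subseteq> G_zeros_upto n" if "n \<ge> N" for n
  proof
    fix p assume p: "p \<in> F"
    have "B / pi < real n" using N that by linarith
    then have "B < pi * real n" by (simp add: field_simps)
    then have "\<bar>Im p\<bar> < pi * real n" using abs_Im_le_cmod[of p] B[OF p] by linarith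
    with p assms(2) show "p \<in> G_zeros_upto n" by (auto simp: G_zeros_upto_def)
  qed
  then show ?thesis using that by blast
qed

text \<open>Lets the value of an unordered sum over the zeros be computed along the squares.\<close>

lemma filterlim_G_zeros_upto: "filterlim G_zeros_upto (finite_subsets_at_top G_zeros) sequentially"
  unfolding filterlim_finite_subsets_at_top
proof (intro allI impI)
  fix X assume "finite X \<and> X \<subseteq> G_zeros"
  then have "finite X" "X \<subseteq> G_zeros" by simp_all
  from finite_subset_G_zeros_upto[OF this] obtain N where N: "\<And>n. n \<ge> N \<Longrightarrow> X \<subseteq> G_zeros_upto n"
    by blast
  show "\<forall>\<^sub>F n in sequentially. finite (G_zeros_upto n) \<and> X \<subseteq> G_zeros_upto n \<and> G_zeros_upto n \<subseteq> G_zeros"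
    using eventually_ge_at_top[of N]
    by eventually_elim (intro conjI finite_G_zeros_upto N G_zeros_upto_subset)
qed

lemma Re_G_zeros: "p \<in> G_zeros \<Longrightarrow> Re p = 0"
  using G_zero_imp_Re_0 by (simp add: G_zeros_def)

text \<open>At \<open>s0 = -1\<close> the quotient \<open>(p + 1) / (s0 - p)\<close> is
  \<open>-1\<close>, so the sums of weights over the squares converge and are bounded. Every finite
  set of zeros lies in a square, and the weights are positive.\<close>

lemma weight_summable_on_G_zeros: "weight summable_on G_zeros"
proof (rule nonneg_bdd_above_summable_on)
  have "(-1 :: complex) \<notin> G_zeros" by (auto dest: Re_G_zeros)
  from partial_fractions_limit[OF this]
  have "(\<lambda>n. \<Sum>p\<in>G_zeros_upto n. weight p * (p + 1) / (-1 - p)) \<longlonglongrightarrow> 1 / G (-1)" .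
  moreover have "(\<Sum>p\<in>G_zeros_upto n. weight p * (p + 1) / (-1 - p)) = - of_real (sum weight (G_zeros_upto n))" for n
    unfolding of_real_sum sum_negf[symmetric]
  proof (rule sum.cong[OF refl])
    fix p assume "p \<in> G_zeros_upto n"
    then have "Re p = 0" using G_zeros_upto_subset Re_G_zeros by blast
    then have "p + 1 \<noteq> 0" by (auto simp: complex_eq_iff)
    have "c * q / - q = - c" if "q \<noteq> 0" for c q :: complex
      using that by simp
    from this[OF \<open>p + 1 \<noteq> 0\<close>] have "weight p * (p + 1) / - (p + 1) = - of_real (weight p)" .
    moreover have "- (p + 1) = -1 - p" by simp
    ultimately show "weight p * (p + 1) / (-1 - p) = - of_real (weight p)" by argo
  qed
  ultimately have "(\<lambda>n. - complex_of_real (sum weight (G_zeros_upto n))) \<longlonglongrightarrow> 1 / G (-1)"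
    by simp
  then have "Bseq (\<lambda>n. - complex_of_real (sum weight (G_zeros_upto n)))"
    using convergent_imp_Bseq convergentI by blast
  then obtain B where B: "\<And>n. cmod (- complex_of_real (sum weight (G_zeros_upto n))) \<le> B"
    unfolding Bseq_def by blast
  show "bdd_above (sum weight ` {F. F \<subseteq> G_zeros \<and> finite F})"
  proof (rule bdd_aboveI2)
    fix F assume "F \<in> {F. F \<subseteq> G_zeros \<and> finite F}"
    then have "finite F" "F \<subseteq> G_zeros" by simp_all
    then obtain n where "\<And>m. m \<ge> n \<Longrightarrow> F \<subseteq> G_zeros_upto m" using finite_subset_G_zeros_upto by blast
    then have "F \<subseteq> G_zeros_upto n" by simp
    then have "sum weight F \<le> sum weight (G_zeros_upto n)"
      using finite_G_zeros_upto weight_pos by (intro sum_mono2) (auto intro: less_imp_le)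
    also have "\<dots> \<le> B" using B[of n] unfolding norm_minus_cancel norm_of_real by linarith
    finally show "sum weight F \<le> B" .
  qed
qed (use weight_pos less_imp_le in blast)

lemma dist_G_zeros_bounded_below:
  fixes s0 :: complex
  assumes "s0 \<notin> G_zeros"
  obtains e where "e > 0" "\<And>p. p \<in> G_zeros \<Longrightarrow> e \<le> dist s0 p"
proof -
  have "isCont G s0" using DERIV_isCont[OF G_has_field_derivative] .
  moreover have "G s0 \<noteq> 0" using assms by (simp add: G_zeros_def)
  ultimately obtain e where "e > 0" "\<And>s. dist s0 s < e \<Longrightarrow> G s \<noteq> 0"
    using continuous_at_avoid[of s0 G 0] by blast
  then show ?thesis using that[of e] unfolding G_zeros_def by (metis mem_Collect_eq not_less)
qed

text \<open>Away from the zeros \<open>(p + 1) / (s0 - p)\<close> is bounded uniformly in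
  \<open>p\<close>, so summability of the weights gives absolute convergence; the limit along the
  squares identifies the sum.\<close>

lemma partial_fractions:
  fixes s0 :: complex
  assumes "s0 \<notin> G_zeros"
  shows "((\<lambda>p. weight p * (p + 1) / (s0 - p)) has_sum 1 / G s0) G_zeros"
proof -
  let ?f = "\<lambda>p :: complex. weight p * (p + 1) / (s0 - p)"
  obtain e where e: "e > 0" "\<And>p. p \<in> G_zeros \<Longrightarrow> e \<le> dist s0 p"
    using dist_G_zeros_bounded_below[OF assms] by blast
  \<comment> \<open>Arises from \<open>|p + 1| \<le> |s0 - p| + |s0 + 1|\<close> after division by
    \<open>|s0 - p| \<ge> e\<close>.\<close>
  define C where "C = 1 + cmod (s0 + 1) / e"
  have "(\<lambda>p. norm (?f p)) summable_on G_zeros"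
  proof (rule summable_on_comparison_test)
    show "(\<lambda>p. C * weight p) summable_on G_zeros"
      by (rule summable_on_cmult_right[OF weight_summable_on_G_zeros])
    fix p assume p: "p \<in> G_zeros"
    define r where "r = cmod (s0 - p)"
    have r: "e \<le> r" using e(2)[OF p] by (simp add: r_def dist_norm)
    have "cmod (p + 1) \<le> r + cmod (s0 + 1)"
      unfolding r_def using norm_triangle_ineq4[of "s0 + 1" "s0 - p"] by (simp add: add.commute)
    then have "cmod (p + 1) / r \<le> (r + cmod (s0 + 1)) / r"
      using r e(1) by (intro divide_right_mono) auto
    also have "\<dots> = 1 + cmod (s0 + 1) / r" using r e(1) by (simp add: add_divide_distrib)
    also have "\<dots> \<le> C" unfolding C_def using r e(1) by (intro add_left_mono divide_left_mono) auto
    finally have "weight p * (cmod (p + 1) / r) \<le> weight p * C"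
      using weight_pos[of p] by (intro mult_left_mono) auto
    then show "norm (?f p) \<le> C * weight p"
      using weight_pos[of p] by (simp add: norm_mult norm_divide r_def mult.commute)
  qed simp
  then have "?f summable_on G_zeros" by (rule abs_summable_summable)
  then obtain L where L: "(?f has_sum L) G_zeros" unfolding summable_on_def by blast
  then have "(\<lambda>n. sum ?f (G_zeros_upto n)) \<longlonglongrightarrow> L"
    unfolding has_sum_def by (rule filterlim_compose[OF _ filterlim_G_zeros_upto])
  then have "L = 1 / G s0" using partial_fractions_limit[OF assms] by (rule LIMSEQ_unique)
  with L show ?thesis by simp
qed

section \<open>Enumeration and isolation of the zeros\<close>

text \<open>The zeros form a countable infinite set. A disc contains finitely many of them, so under
  an injective enumeration only finitely many indices stay in it.\<close>

lemma enumerate_G_zeros: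
  obtains e :: "nat \<Rightarrow> complex"
  where "bij_betw e UNIV G_zeros" "filterlim e at_infinity sequentially"
proof -
  have "G_zeros = (\<Union>n. G_zeros_upto n)"
  proof
    show "G_zeros \<subseteq> (\<Union>n. G_zeros_upto n)"
    proof
      fix p assume "p \<in> G_zeros"
      then obtain N where "\<And>n. n \<ge> N \<Longrightarrow> {p} \<subseteq> G_zeros_upto n"
        using finite_subset_G_zeros_upto[of "{p}"] by auto
      then show "p \<in> (\<Union>n. G_zeros_upto n)" by blast
    qed
  qed (use G_zeros_upto_subset in blast)
  then have "countable G_zeros" using finite_G_zeros_upto by (metis countable_UN countable_finite countableI_type)
  then have bij: "bij_betw (from_nat_into G_zeros) UNIV G_zeros"
    using infinite_G_zeros by (rule bij_betw_from_nat_into)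
  have "filterlim (from_nat_into G_zeros) at_infinity sequentially"
    unfolding filterlim_at_infinity[OF order_refl]
  proof (intro allI impI)
    fix r :: real assume "r > 0"
    have "inj (from_nat_into G_zeros)" using bij by (rule bij_betw_imp_inj_on)
    from finite_vimageI[OF finite_G_zeros_cball this]
    have "\<forall>\<^sub>F n in sequentially. from_nat_into G_zeros n \<notin> G_zeros \<inter> cball 0 r"
      unfolding cofinite_eq_sequentially[symmetric] eventually_cofinite vimage_def not_not .
    then show "\<forall>\<^sub>F n in sequentially. r \<le> cmod (from_nat_into G_zeros n)"
      by eventually_elim (use bij in \<open>auto simp: bij_betw_def\<close>)
  qed
  with bij show ?thesis using that by blast
qed

lemma eventually_not_in_G_zeros:
  fixes s0 :: complex
  shows "\<forall>\<^sub>F s in at s0. s \<notin> G_zeros"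
proof -
  have "\<forall>\<^sub>F s in at s0. s \<notin> G_zeros \<inter> cball 0 (cmod s0 + 1)"
    using islimpt_finite[OF finite_G_zeros_cball] unfolding islimpt_iff_eventually by blast
  moreover have "\<forall>\<^sub>F s in at s0. s \<in> ball s0 1" by (rule eventually_at_in_open') auto
  ultimately show ?thesis
  proof eventually_elim
    case (elim s)
    then have "cmod s \<le> cmod s0 + 1"
      using norm_triangle_sub[of s s0] by (simp add: dist_norm norm_minus_commute)
    with elim show ?case by auto
  qed
qed

section \<open>The zero-free series and the counterexample in the disc\<close>

theorem mainTheorem2:
  shows "(\<exists>(w :: nat \<Rightarrow> complex) (a :: nat \<Rightarrow> real).
            (\<forall>k. Re (w k) > 1 / 2) \<and> (\<forall>k. a k > 0) \<and>
            filterlim w at_infinity sequentially \<and> summable a \<and>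
            (let F = pole_series (\<lambda>k. complex_of_real (a k) * w k) w
             in (\<forall>z. z \<notin> range w \<longrightarrow> summable (\<lambda>k. complex_of_real (a k) * w k / (z - w k))) \<and>
                F meromorphic_on UNIV \<and>
                \<not> (\<exists>z. \<not> is_pole F z \<and> F z = 0)))
       \<and>
         \<not> (\<forall>(\<rho> :: real) (\<theta> :: real) (p :: nat \<Rightarrow> complex) (a :: nat \<Rightarrow> real).
              0 < \<rho> \<longrightarrow>
              (\<forall>k. cmod (p k) < \<rho>) \<longrightarrow>
              p \<longlonglongrightarrow> complex_of_real \<rho> * exp (\<i> * complex_of_real \<theta>) \<longrightarrow>
              (\<forall>k. a k > 0) \<longrightarrow>
              summable a \<longrightarrow>
              (let f = pole_series (\<lambda>k. complex_of_real (a k)) p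
               in infinite {z. cmod z < \<rho> \<and> \<not> is_pole f z \<and> f z = 0}))"
  (is "?part1 \<and> \<not> ?conj")
proof -
  obtain e where e: "bij_betw e UNIV G_zeros" and e_lim: "filterlim e at_infinity sequentially"
    using enumerate_G_zeros .
  \<comment> \<open>Undoes the shift \<open>s = w - 1\<close>: the \<open>w k\<close> are the zeros
    of \<open>G (z - 1)\<close>, on the line \<open>Re z = 1\<close>.\<close>
  define w a where "w k = e k + 1" and "a k = weight (e k)" for k
  define F where "F = pole_series (\<lambda>k. complex_of_real (a k) * w k) w"
  have eZ: "e k \<in> G_zeros" for k using e by (auto simp: bij_betw_def)
  have Re_w: "Re (w k) = 1" for k using Re_G_zeros[OF eZ[of k]] by (simp add: w_def)
  have w0: "w k \<noteq> 0" for k using Re_w[of k] by auto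
  have a_pos: "a k > 0" for k by (simp add: a_def weight_pos)
  have range_w: "z \<in> range w \<longleftrightarrow> z - 1 \<in> G_zeros" for z
  proof -
    have "z \<in> range w \<longleftrightarrow> z - 1 \<in> range e"
      by (auto simp: w_def image_iff algebra_simps)
    then show ?thesis using e by (simp add: bij_betw_def)
  qed
  have w_lim: "filterlim w at_infinity sequentially"
    unfolding w_def using tendsto_add_filterlim_at_infinity'[OF e_lim tendsto_const] .
  have "(\<lambda>k. weight (e k)) summable_on UNIV"
    using summable_on_reindex_bij_betw[OF e, of weight] weight_summable_on_G_zeros by simp
  then have sum_a: "summable a" unfolding a_def by (rule summable_on_imp_summable)
  have sums: "(\<lambda>k. complex_of_real (a k) * w k / (z - w k)) sums (1 / G (z - 1))"
    if "z \<notin> range w" for z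
  proof -
    have "z - 1 \<notin> G_zeros" using that range_w by blast
    from has_sum_reindex_bij_betw[OF e, of "\<lambda>p. weight p * (p + 1) / (z - 1 - p)" "1 / G (z - 1)"]
      partial_fractions[OF this]
    have "((\<lambda>k. weight (e k) * (e k + 1) / (z - 1 - e k)) has_sum 1 / G (z - 1)) UNIV" by simp
    moreover have "z - 1 - e k = z - w k" for k by (simp add: w_def)
    ultimately have "((\<lambda>k. complex_of_real (a k) * w k / (z - w k)) has_sum 1 / G (z - 1)) UNIV"
      by (simp add: a_def w_def)
    then show ?thesis by (rule has_sum_imp_sums)
  qed
  have F_eq: "F z = 1 / G (z - 1)" if "z \<notin> range w" for z
    unfolding F_def pole_series_def using sums[OF that] by (rule sums_unique[symmetric])
  \<comment> \<open>At the points \<open>w k\<close> the series has a meaningless value; poles and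
    meromorphy depend only on punctured neighbourhoods, where \<open>F z = 1 / G (z - 1)\<close>
    eventually holds.\<close>
  have ev_range_w: "\<forall>\<^sub>F z in at z0. z \<notin> range w" for z0
  proof -
    have "filterlim (\<lambda>z. z - 1) (at (z0 - 1)) (at z0)"
      by (rule filterlim_atI) (auto intro!: tendsto_intros simp: eventually_at_filter)
    from eventually_compose_filterlim[OF eventually_not_in_G_zeros this] show ?thesis
      by (simp add: range_w)
  qed
  have ev_F: "\<forall>\<^sub>F z in at z0. F z = 1 / G (z - 1)" for z0
    using ev_range_w[of z0] by eventually_elim (rule F_eq)
  have pole_F: "is_pole F z0" if "z0 \<in> range w" for z0
  proof -
    have 0: "G (z0 - 1) = 0" using that range_w by (simp add: G_zeros_def)
    have "is_pole (\<lambda>z. 1 / G (z - 1)) z0"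
    proof (rule is_pole_divide)
      show "filterlim (\<lambda>z. G (z - 1)) (at 0) (at z0)"
      proof (rule filterlim_atI)
        have "isCont (\<lambda>z. G (z - 1)) z0"
          unfolding G_def by (intro continuous_intros)
        then show "((\<lambda>z. G (z - 1)) \<longlongrightarrow> 0) (at z0)"
          unfolding isCont_def using 0 by simp
        show "\<forall>\<^sub>F z in at z0. G (z - 1) \<noteq> 0"
          using ev_range_w[of z0] by eventually_elim (simp add: range_w G_zeros_def)
      qed
    qed auto
    then show ?thesis using is_pole_cong[OF ev_F refl] by blast
  qed
  have F_ne: "F z \<noteq> 0" if "z \<notin> range w" for z
    using that by (simp add: F_eq range_w G_zeros_def)
  have mero: "F meromorphic_on UNIV"
  proof -
    have "(\<lambda>z. G (z - 1)) analytic_on UNIV"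
      by (subst analytic_on_open) (auto intro!: holomorphic_intros)
    then have "(\<lambda>z. G (z - 1)) meromorphic_on UNIV" by (rule analytic_on_imp_meromorphic_on)
    then have "(\<lambda>z. 1 / G (z - 1)) meromorphic_on UNIV"
      by (intro meromorphic_on_divide meromorphic_on_const)
    then show ?thesis using meromorphic_on_cong[OF ev_F refl] by blast
  qed
  have part1: ?part1
  proof (intro exI conjI allI)
    show "let F = pole_series (\<lambda>k. complex_of_real (a k) * w k) w
             in (\<forall>z. z \<notin> range w \<longrightarrow> summable (\<lambda>k. complex_of_real (a k) * w k / (z - w k))) \<and>
                F meromorphic_on UNIV \<and>
                \<not> (\<exists>z. \<not> is_pole F z \<and> F z = 0)"
      unfolding Let_def F_def[symmetric]
      using mero F_ne pole_F sums sums_summable by blast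
  qed (use w_lim sum_a a_pos Re_w in auto)

  \<comment> \<open>\<open>z = 1 / w - 1\<close> maps \<open>Re w > 1/2\<close> onto the unit disc and \<open>\<infinity>\<close> to \<open>-1\<close>,
      and it turns \<open>F w\<close> into \<open>- f z / w\<close>.\<close>
  define p where "p k = 1 / w k - 1" for k
  define f where "f = pole_series (\<lambda>k. complex_of_real (a k)) p"
  \<comment> \<open>\<open>Re (w k) > 1 / 2\<close> says that \<open>w k\<close> is closer to 1 than
    to 0, that is, \<open>|1 - w k| < |w k|\<close>.\<close>
  have p_disc: "cmod (p k) < 1" for k
  proof -
    have "cmod (1 - w k) < cmod (w k)"
      unfolding cmod_def using Re_w[of k] by (intro real_sqrt_less_mono) simp
    moreover have "p k = (1 - w k) / w k" using w0 by (simp add: p_def diff_divide_distrib)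
    ultimately show ?thesis using w0[of k] by (simp add: norm_divide)
  qed
  have p_lim: "p \<longlonglongrightarrow> complex_of_real 1 * exp (\<i> * complex_of_real pi)"
  proof -
    have "(\<lambda>k. inverse (w k)) \<longlonglongrightarrow> 0"
      using filterlim_compose[OF tendsto_inverse_0 w_lim] .
    then have "(\<lambda>k. inverse (w k) - 1) \<longlonglongrightarrow> 0 - 1" by (intro tendsto_intros)
    then show ?thesis by (simp add: p_def[abs_def] inverse_eq_divide)
  qed
  \<comment> \<open>The inverse of the substitution \<open>z = 1 / w - 1\<close>.\<close>
  define T where "T z = 1 / (z + 1)" for z :: complex
  have T_p: "T (p k) = w k" for k by (simp add: T_def p_def)
  have range_p: "T z \<in> range w \<longleftrightarrow> z \<in> range p" if "z \<noteq> -1" for z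
  proof -
    have "T z = w k \<longleftrightarrow> z = p k" for k
    proof -
      have "z + 1 \<noteq> 0" using that by (simp add: add_eq_0_iff2)
      then have "1 / (z + 1) = w k \<longleftrightarrow> z + 1 = 1 / w k" using w0[of k] by (auto simp: divide_simps mult.commute)
      then show ?thesis unfolding T_def p_def eq_diff_eq .
    qed
    then show ?thesis by (simp add: image_iff)
  qed
  \<comment> \<open>Since \<open>z - p k = 1 / T z - 1 / w k\<close>, the factor \<open>w k\<close>
    in the numerators of \<open>F\<close> is absorbed and the coefficients become the positive reals
    \<open>a k\<close>.\<close>
  have f_eq: "f z = - T z * F (T z)" if "z \<noteq> -1" "z \<notin> range p" for z
  proof -
    have Tz: "T z \<notin> range w" using that range_p by blast
    have "(\<lambda>k. - T z * (complex_of_real (a k) * w k / (T z - w k))) sums (- T z * (1 / G (T z - 1)))"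
      by (rule sums_mult[OF sums[OF Tz]])
    moreover have "- T z * (complex_of_real (a k) * w k / (T z - w k)) = a k / (z - p k)" for k
    proof -
      have T0: "T z \<noteq> 0" using that by (simp add: T_def add_eq_0_iff2)
      have ne: "T z - w k \<noteq> 0" using Tz by auto
      have "z - p k = 1 / T z - 1 / w k" using that by (simp add: T_def p_def)
      also have "\<dots> = - (T z - w k) / (T z * w k)" using T0 w0[of k] by (simp add: field_simps)
      finally have "z - p k = - (T z - w k) / (T z * w k)" .
      moreover have "- t * (c * v / d) = c / (- d / (t * v))" if "t \<noteq> 0" "v \<noteq> 0" "d \<noteq> 0" for t v d c :: complex
        using that by simp
      ultimately show ?thesis using T0 ne w0[of k] by metis
    qed
    ultimately have "(\<lambda>k. a k / (z - p k)) sums (- T z * (1 / G (T z - 1)))" by simp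
    then show ?thesis
      unfolding f_def pole_series_def F_eq[OF Tz] by (rule sums_unique[symmetric])
  qed
  \<comment> \<open>Near \<open>p k\<close> the map \<open>T\<close> is injective and
    \<open>- T z\<close> tends to \<open>- w k \<noteq> 0\<close>, so the pole of \<open>F\<close>
    at \<open>w k\<close> is carried over to \<open>f\<close>.\<close>
  have pole_f: "is_pole f (p k)" for k
  proof -
    have ne: "p k \<noteq> -1" using w0[of k] by (simp add: p_def)
    have cont: "isCont T (p k)"
      unfolding T_def using ne by (intro continuous_intros) (simp add: add_eq_0_iff2)
    have lim: "filterlim T (at (w k)) (at (p k))"
    proof (rule filterlim_atI)
      show "(T \<longlongrightarrow> w k) (at (p k))" using cont by (simp add: isCont_def T_p)
      have "\<forall>\<^sub>F z in at (p k). z \<noteq> p k" by (simp add: eventually_at_filter)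
      then show "\<forall>\<^sub>F z in at (p k). T z \<noteq> w k"
        by eventually_elim (simp add: T_p[symmetric], simp add: T_def)
    qed
    have "filterlim (\<lambda>z. F (T z)) at_infinity (at (p k))"
      using filterlim_compose[OF _ lim] pole_F[of "w k"] unfolding is_pole_def by blast
    moreover have "((\<lambda>z. - T z) \<longlongrightarrow> - w k) (at (p k))"
      using lim by (intro tendsto_minus) (simp add: filterlim_at)
    ultimately have "filterlim (\<lambda>z. - T z * F (T z)) at_infinity (at (p k))"
      using w0[of k] by (intro tendsto_mult_filterlim_at_infinity[of _ "- w k"]) auto
    then have "is_pole (\<lambda>z. - T z * F (T z)) (p k)" unfolding is_pole_def .
    moreover have "\<forall>\<^sub>F z in at (p k). f z = - T z * F (T z)"
    proof -
      have "\<forall>\<^sub>F z in at (p k). T z \<notin> range w"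
        using eventually_compose_filterlim[OF ev_range_w lim] .
      moreover have "\<forall>\<^sub>F z in at (p k). z \<noteq> -1"
        by (rule eventually_at_in_open'[of "- {-1}", simplified]) (use ne in auto)
      ultimately show ?thesis by eventually_elim (use f_eq range_p in blast)
    qed
    ultimately show ?thesis by (rule is_pole_cong[THEN iffD2, OF _ refl, rotated])
  qed
  have no_zeros: "{z. cmod z < 1 \<and> \<not> is_pole f z \<and> f z = 0} = {}"
  proof -
    have "f z \<noteq> 0" if "cmod z < 1" "\<not> is_pole f z" for z
    proof -
      \<comment> \<open>A point of the disc that is not a pole differs from every \<open>p k\<close>
        and from the boundary point \<open>-1\<close>, so \<open>f z\<close> is a product of the
        nonzero values \<open>- T z\<close> and \<open>F (T z)\<close>.\<close>
      have z: "z \<notin> range p" "z \<noteq> -1" using that pole_f by auto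
      then show ?thesis
        using F_ne[of "T z"] range_p[of z] f_eq[of z] by (simp add: T_def add_eq_0_iff2)
    qed
    then show ?thesis by blast
  qed
  have part2: "\<not> ?conj"
  proof
    assume ?conj
    note conj = this[THEN spec[of _ 1], THEN spec[of _ pi], THEN spec[of _ p], THEN spec[of _ a]]
    have disc: "\<forall>k. cmod (p k) < 1" and pos: "\<forall>k. a k > 0"
      using p_disc a_pos by simp_all
    have "infinite {z. cmod z < 1 \<and> \<not> is_pole f z \<and> f z = 0}"
      using conj[THEN mp, OF zero_less_one, THEN mp, OF disc, THEN mp, OF p_lim,
          THEN mp, OF pos, THEN mp, OF sum_a]
      unfolding Let_def f_def[symmetric] .
    then show False unfolding no_zeros by simp
  qed
  from part1 part2 show ?thesis by (rule conjI)
qed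

end
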